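(* Let $\mathcal{D}$ be a probability distribution with finite support $\mathcal{K}$, $|\mathcal{K}|\ge2$. Let $p_1\ge p_2\ge\dots\ge p_{|\mathcal{K}|}$ be the values assumed (with multiplicity) by its probability mass function, and let $$T_C(\mathcal{D})=\sum_{i=1}^{|\mathcal{K}|}i\,p_i,\qquad T_Q(\mathcal{D})=\sum_{i=1}^{|\mathcal{K}|}\sqrt i\,p_i$$ be the expected runtimes of the optimal classical single-key guessing algorithm and of Montanaro's quantum algorithm, respectively. Then the quantum speed-up $s:=\frac{\log T_C(\mathcal{D})}{\log T_Q(\mathcal{D})}$ satisfies $$s\;\ge\;2\cdot\frac{\mathrm{H}_{1/2}(\mathcal{D})-\log(1+\log|\mathcal{K}|)}{\mathrm{H}_{2/3}(\mathcal{D})}.$$ Moreover, for a product distribution $\mathcal{D}=\chi^n$, where $\chi$ is a fixed distribution with finite support of size at least $2$, the speed-up satisfies, as $n\to\infty$ (with implied constant depending only on $\chi$), $$s\;\ge\;2\cdot\frac{\mathrm{H}_{1/2}(\chi)}{\mathrm{H}_{2/3}(\chi)}\left(1-\mathcal{O}\left(\frac{\log n}{n}\right)\right).$$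
   Context: All logarithms are base 2. For $\alpha>0$, $\alpha\ne1$, the Rényi entropy of a discrete distribution $\mathcal{D}$ with support $\mathcal{K}$ and mass function $P_{\mathcal{D}}$ is $\mathrm{H}_\alpha(\mathcal{D})=\frac{1}{1-\alpha}\log\left(\sum_{x\in\mathcal{K}}P_{\mathcal{D}}(x)^\alpha\right)$. The product distribution $\chi^n$ samples $n$ independent coordinates from $\chi$. Single-key guessing problem: for $k\leftarrow\mathcal{D}$, given $\mathcal{D}$ and oracle access to the indicator function of $k$ on $\mathcal{K}$, find $k$. The optimal classical algorithm tries keys in decreasing order of probability, with expected number of trials $T_C(\mathcal{D})$; Montanaro's optimal quantum algorithm has (up to a constant factor, which is disregarded in the definition of $s$) expected runtime $T_Q(\mathcal{D})$. *)

theory Defs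
  imports "HOL-Probability.Probability" "HOL-Library.Landau_Symbols" "HOL-Library.Multiset"
begin

text \<open>
  A discrete distribution is a \<^typ>\<open>'a pmf\<close>; its support, called K in the comments below, is
  \<^term>\<open>set_pmf D\<close>, the set of points of positive mass.
\<close>

text \<open>
  Meaningful for \<open>\<alpha> > 0\<close>, \<open>\<alpha> \<noteq> 1\<close>; at \<open>\<alpha> = 1\<close> it is 0 by division by zero, not the Shannon entropy.
\<close>

definition renyi_entropy :: "real \<Rightarrow> 'a pmf \<Rightarrow> real" where
  "renyi_entropy \<alpha> D = 1 / (1 - \<alpha>) * log 2 (\<Sum>x\<in>set_pmf D. pmf D x powr \<alpha>)"

text \<open>
  The multiset of masses (so with multiplicity) of a finitely supported distribution, listed in
  decreasing order. List positions start at 0, hence the shift below: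
  \<open>sorted_mass D i\<close> is $p_i$ for $1 \le i \le |K|$.
\<close>

definition sorted_masses :: "'a pmf \<Rightarrow> real list" where
  "sorted_masses D = rev (sorted_list_of_multiset (image_mset (pmf D) (mset_set (set_pmf D))))"

definition sorted_mass :: "'a pmf \<Rightarrow> nat \<Rightarrow> real" where
  "sorted_mass D i = sorted_masses D ! (i - 1)"

definition classical_runtime :: "'a pmf \<Rightarrow> real" where
  "classical_runtime D = (\<Sum>i=1..card (set_pmf D). real i * sorted_mass D i)"

definition quantum_runtime :: "'a pmf \<Rightarrow> real" where
  "quantum_runtime D = (\<Sum>i=1..card (set_pmf D). sqrt (real i) * sorted_mass D i)"

definition quantum_speedup :: "'a pmf \<Rightarrow> real" where
  "quantum_speedup D = log 2 (classical_runtime D) / log 2 (quantum_runtime D)"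

end

(*
  Cauchy-Schwarz gives (sum sqrt p_i)^2 <= (sum 1/i) * T_C, so T_C is at least 2^H_{1/2} up to a
  harmonic number. Monotonicity of the p_i gives T_Q <= (sum p_i^(2/3))^(3/2), that is,
  log T_Q <= H_{2/3} / 2. The asymptotic statement follows because Renyi entropies are additive on
  product distributions, whereas the support of chi^n only contributes a term
  log (1 + n log |supp chi|) = O(log n).
*)

theory Submission
  imports Defs "HOL-Real_Asymp.Real_Asymp"
begin

section \<open>Masses in decreasing order\<close>

lemma mset_sorted_masses: "mset (sorted_masses D) = image_mset (pmf D) (mset_set (set_pmf D))"
  by (simp add: sorted_masses_def)

lemma length_sorted_masses: "length (sorted_masses D) = card (set_pmf D)"
  by (simp add: mset_sorted_masses flip: size_mset)

text \<open>The support and the decreasing list carry the same multiset of masses. Power sums, which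
  ignore the order, can thus be moved to ranks, in terms of which the runtimes are defined.\<close>

lemma sum_sorted_mass:
  assumes "finite (set_pmf D)"
  shows "(\<Sum>i=1..card (set_pmf D). g (sorted_mass D i)) = (\<Sum>x\<in>set_pmf D. g (pmf D x))"
proof -
  have "(\<Sum>i=1..card (set_pmf D). g (sorted_mass D i))
      = (\<Sum>i<card (set_pmf D). g (sorted_masses D ! i))"
    by (rule sum.reindex_bij_witness[where i = Suc and j = "\<lambda>i. i - 1"])
       (auto simp: sorted_mass_def)
  also have "\<dots> = sum_list (map g (sorted_masses D))"
    by (simp add: sum_list_sum_nth length_sorted_masses atLeast0LessThan)
  also have "\<dots> = sum_mset (image_mset g (mset (sorted_masses D)))"
    by (simp flip: sum_mset_sum_list)
  also have "\<dots> = (\<Sum>x\<in>set_pmf D. g (pmf D x))"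
    by (simp add: mset_sorted_masses image_mset.compositionality o_def sum_unfold_sum_mset)
  finally show ?thesis .
qed

lemma sorted_mass_antimono:
  assumes "1 \<le> i" "i \<le> j" "j \<le> card (set_pmf D)"
  shows "sorted_mass D j \<le> sorted_mass D i"
proof -
  have "sorted_wrt (\<ge>) (sorted_masses D)"
    by (simp add: sorted_masses_def sorted_wrt_rev)
  then show ?thesis
    using assms by (cases "i = j")
      (auto simp: sorted_mass_def sorted_wrt_iff_nth_less length_sorted_masses)
qed

lemma sorted_mass_pos:
  assumes "finite (set_pmf D)" "1 \<le> i" "i \<le> card (set_pmf D)"
  shows "0 < sorted_mass D i"
proof -
  have "sorted_mass D i \<in> set (sorted_masses D)"
    using assms by (simp add: sorted_mass_def length_sorted_masses)
  also have "\<dots> = pmf D ` set_pmf D"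
    using assms by (simp add: mset_sorted_masses flip: set_mset_mset)
  finally show ?thesis
    by (auto simp: pmf_positive)
qed

lemma sum_sorted_mass_eq_1:
  assumes "finite (set_pmf D)"
  shows "(\<Sum>i=1..card (set_pmf D). sorted_mass D i) = 1"
  using sum_sorted_mass[OF assms, of "\<lambda>x. x"] sum_pmf_eq_1[OF assms, of D] by simp

text \<open>The masses sum to 1, and rank 2 has positive mass and weight above 1. For the weights i
  and sqrt i, both runtimes exceed 1, so the speed-up is a quotient of positive logarithms.\<close>

lemma weighted_sorted_mass_gt_1:
  fixes w :: "nat \<Rightarrow> real"
  assumes fin: "finite (set_pmf D)" and card: "card (set_pmf D) \<ge> 2"
    and w1: "\<And>i. 1 \<le> i \<Longrightarrow> 1 \<le> w i" and w2: "1 < w 2"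
  shows "1 < (\<Sum>i=1..card (set_pmf D). w i * sorted_mass D i)"
proof -
  have "(\<Sum>i=1..card (set_pmf D). sorted_mass D i)
      < (\<Sum>i=1..card (set_pmf D). w i * sorted_mass D i)"
  proof (rule sum_strict_mono_ex1)
    show "\<forall>i\<in>{1..card (set_pmf D)}. sorted_mass D i \<le> w i * sorted_mass D i"
      using w1 sorted_mass_pos[OF fin] by (simp add: mult_le_cancel_right1 less_le_not_le)
    show "\<exists>i\<in>{1..card (set_pmf D)}. sorted_mass D i < w i * sorted_mass D i"
      using w2 card sorted_mass_pos[OF fin, of 2] by (intro bexI[of _ 2]) auto
  qed simp
  then show ?thesis
    unfolding sum_sorted_mass_eq_1[OF fin] .
qed

section \<open>Runtimes against Renyi entropies\<close>

lemma harm_le_1_plus_log2: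
  assumes "n \<ge> 1"
  shows "(harm n :: real) \<le> 1 + log 2 (real n)"
proof -
  have ln_le: "ln x \<le> log 2 x" if "1 \<le> x" for x :: real
  proof -
    have "ln 2 \<le> (1 :: real)" using ln_le_minus_one[of "2::real"] by simp
    then show ?thesis
      using that by (simp add: log_def field_simps mult_left_le)
  qed
  \<comment> \<open>The difference decreases to the Euler-Mascheroni constant from its value 1 at n
    = 1. The library sequence is shifted by one, hence the indices 0 and
    \<open>n - 1\<close>.\<close>
  have "harm n - ln (real n) \<le> harm 1 - ln (real 1)"
    using decseqD[OF decseq_harm_diff_ln, of 0 "n - 1"] assms by simp
  then have "(harm n :: real) \<le> 1 + ln (real n)"
    by (simp add: harm_expand)
  also have "\<dots> \<le> 1 + log 2 (real n)"
    using assms by (simp add: ln_le)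
  finally show ?thesis .
qed

text \<open>Cauchy-Schwarz for the splitting \<open>sqrt p\<^sub>i = (1 / sqrt i) * sqrt (i * p\<^sub>i)\<close>.\<close>

lemma renyi_half_le_log_classical_runtime:
  assumes fin: "finite (set_pmf D)" and card: "card (set_pmf D) \<ge> 2"
  shows "renyi_entropy (1/2) D - log 2 (1 + log 2 (real (card (set_pmf D))))
           \<le> log 2 (classical_runtime D)"
proof -
  define K where "K = card (set_pmf D)"
  define S where "S = (\<Sum>x\<in>set_pmf D. sqrt (pmf D x))"
  define T where "T = classical_runtime D"
  define L where "L = 1 + log 2 (real K)"
  have T: "1 < T"
    unfolding T_def classical_runtime_def using assms by (intro weighted_sorted_mass_gt_1) auto
  have L: "0 < L"
    unfolding L_def using card by (simp add: K_def add_pos_nonneg)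
  have S: "0 < S"
    unfolding S_def using fin by (intro sum_pos) (auto simp: set_pmf_iff set_pmf_not_empty)
  have "S = (\<Sum>i=1..K. sqrt (sorted_mass D i))"
    unfolding S_def K_def by (rule sum_sorted_mass[OF fin, symmetric])
  also have "\<dots> = (\<Sum>i=1..K. sqrt (inverse (real i)) * sqrt (real i * sorted_mass D i))"
    by (intro sum.cong) (auto simp flip: real_sqrt_mult)
  \<comment> \<open>From here the chain bounds the square of \<open>S\<close>: the equations so far
    are substituted under the square.\<close>
  also have "\<dots>\<^sup>2 \<le> (\<Sum>i=1..K. (sqrt (inverse (real i)))\<^sup>2)
                 * (\<Sum>i=1..K. (sqrt (real i * sorted_mass D i))\<^sup>2)"
    by (rule Cauchy_Schwarz_ineq_sum)
  also have "(\<Sum>i=1..K. (sqrt (inverse (real i)))\<^sup>2) = harm K"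
    by (simp add: harm_def)
  also have "(\<Sum>i=1..K. (sqrt (real i * sorted_mass D i))\<^sup>2) = T"
    unfolding T_def classical_runtime_def K_def
    using sorted_mass_pos[OF fin] by (intro sum.cong) (auto simp: less_imp_le)
  also have "harm K * T \<le> L * T"
    unfolding L_def using T card by (intro mult_right_mono harm_le_1_plus_log2) (auto simp: K_def)
  finally have "log 2 (S\<^sup>2) \<le> log 2 (L * T)"
    using S L T by simp
  \<comment> \<open>The prefactor 1 / (1 - 1/2) = 2 is the exponent of \<open>S\<close>.\<close>
  moreover have "log 2 (S\<^sup>2) = renyi_entropy (1/2) D"
    using S by (simp add: renyi_entropy_def S_def powr_half_sqrt log_nat_power)
  ultimately show ?thesis
    using L T by (simp add: log_mult T_def L_def K_def)
qed

text \<open>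
  Monotonicity of the masses gives \<open>i * p\<^sub>i powr (2/3) \<le> (\<Sum>j. p\<^sub>j powr (2/3))\<close>; the square root of
  this bounds the factor \<open>sqrt i * p\<^sub>i powr (1/3)\<close> of the summand \<open>sqrt i * p\<^sub>i\<close>.
\<close>

lemma log_quantum_runtime_le_renyi:
  assumes fin: "finite (set_pmf D)" and card: "card (set_pmf D) \<ge> 2"
  shows "log 2 (quantum_runtime D) \<le> renyi_entropy (2/3) D / 2"
proof -
  define K where "K = card (set_pmf D)"
  define S where "S = (\<Sum>x\<in>set_pmf D. pmf D x powr (2/3))"
  have S: "0 < S"
    unfolding S_def using fin by (intro sum_pos) (auto simp: set_pmf_iff set_pmf_not_empty)
  have S_eq: "S = (\<Sum>i=1..K. sorted_mass D i powr (2/3))"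
    unfolding S_def K_def by (rule sum_sorted_mass[OF fin, symmetric])
  have Q: "1 < quantum_runtime D"
    unfolding quantum_runtime_def using assms by (intro weighted_sorted_mass_gt_1) auto
  have "quantum_runtime D \<le> (\<Sum>i=1..K. sqrt S * sorted_mass D i powr (2/3))"
    unfolding quantum_runtime_def K_def[symmetric]
  proof (rule sum_mono)
    fix i assume i: "i \<in> {1..K}"
    let ?p = "sorted_mass D i"
    have p: "0 < ?p" using sorted_mass_pos[OF fin] i by (simp add: K_def)
    have "real i * ?p powr (2/3) = (\<Sum>j=1..i. ?p powr (2/3))" by simp
    also have "\<dots> \<le> (\<Sum>j=1..i. sorted_mass D j powr (2/3))"
      using i p by (intro sum_mono powr_mono2 sorted_mass_antimono) (auto simp: K_def)
    also have "\<dots> \<le> S"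
      unfolding S_eq using i by (intro sum_mono2) auto
    finally have "sqrt (real i * ?p powr (2/3)) \<le> sqrt S" by simp
    then have "sqrt (real i) * ?p powr (1/3) \<le> sqrt S"
      using p by (simp add: real_sqrt_mult powr_powr flip: powr_half_sqrt)
    then have "sqrt (real i) * ?p powr (1/3) * ?p powr (2/3) \<le> sqrt S * ?p powr (2/3)"
      by (intro mult_right_mono) auto
    moreover have "?p powr (1/3) * ?p powr (2/3) = ?p"
      using p by (simp flip: powr_add)
    ultimately show "sqrt (real i) * ?p \<le> sqrt S * ?p powr (2/3)"
      by (simp add: mult.assoc)
  qed
  also have "\<dots> = S powr (1/2) * S powr 1"
    using S by (simp add: S_eq sum_distrib_left powr_half_sqrt)
  also have "\<dots> = S powr (3/2)"
    by (simp only: flip: powr_add) simp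
  finally have "log 2 (quantum_runtime D) \<le> log 2 (S powr (3/2))"
    using Q S by simp
  \<comment> \<open>The prefactor 1 / (1 - 2/3) is 3, so the exponent 3/2 yields half the entropy;
    this half becomes the factor 2 in the speed-up bound.\<close>
  also have "\<dots> = renyi_entropy (2/3) D / 2"
    using S by (simp add: renyi_entropy_def S_def log_powr)
  finally show ?thesis .
qed

lemma quantum_speedup_ge:
  assumes fin: "finite (set_pmf D)" and card: "card (set_pmf D) \<ge> 2"
  shows "quantum_speedup D \<ge>
           2 * ((renyi_entropy (1/2) D - log 2 (1 + log 2 (real (card (set_pmf D)))))
                / renyi_entropy (2/3) D)"
proof -
  have "1 < quantum_runtime D"
    unfolding quantum_runtime_def using assms by (intro weighted_sorted_mass_gt_1) auto
  then have Q: "0 < log 2 (quantum_runtime D)" by simp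
  have "1 < classical_runtime D"
    unfolding classical_runtime_def using assms by (intro weighted_sorted_mass_gt_1) auto
  then have C: "0 \<le> log 2 (classical_runtime D)" by simp
  \<comment> \<open>The order of the two estimates matters. The left numerator can be negative (for
    two unequal masses H_{1/2} < 1 = log (1 + log 2)), so the denominator is changed only once the
    numerator is log T_C.\<close>
  have "(renyi_entropy (1/2) D - log 2 (1 + log 2 (real (card (set_pmf D)))))
          / (renyi_entropy (2/3) D / 2)
      \<le> log 2 (classical_runtime D) / (renyi_entropy (2/3) D / 2)"
    using renyi_half_le_log_classical_runtime[OF assms] log_quantum_runtime_le_renyi[OF assms] Q
    by (intro divide_right_mono) auto
  also have "\<dots> \<le> log 2 (classical_runtime D) / log 2 (quantum_runtime D)"
    using log_quantum_runtime_le_renyi[OF assms] Q C by (intro divide_left_mono) auto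
  finally show ?thesis
    by (simp add: quantum_speedup_def mult.commute)
qed

text \<open>With two or more support points every mass t lies strictly between 0 and 1, where t powr
  \<alpha> > t; hence the power sum exceeds 1.\<close>

lemma renyi_entropy_pos:
  assumes fin: "finite (set_pmf D)" and card: "card (set_pmf D) \<ge> 2" and "0 < \<alpha>" "\<alpha> < 1"
  shows "0 < renyi_entropy \<alpha> D"
proof -
  have lt1: "pmf D x < 1" if "x \<in> set_pmf D" for x
  proof (rule ccontr)
    assume "\<not> pmf D x < 1"
    then have "pmf D x = 1" using pmf_le_1[of D x] by linarith
    then have "set_pmf D = {x}"
      by (metis measure_pmf_single measure_pmf.prob_eq_1 AE_measure_pmf_iff set_pmf_not_empty
          subset_singletonD UNIV_I sets_measure_pmf subsetI)
    then show False using card by simp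
  qed
  have "(\<Sum>x\<in>set_pmf D. pmf D x) < (\<Sum>x\<in>set_pmf D. pmf D x powr \<alpha>)"
  proof (rule sum_strict_mono[OF fin set_pmf_not_empty])
    fix x assume x: "x \<in> set_pmf D"
    then have "pmf D x powr 1 < pmf D x powr \<alpha>"
      using lt1[OF x] pmf_positive[OF x] \<open>\<alpha> < 1\<close> by (intro powr_less_mono') auto
    then show "pmf D x < pmf D x powr \<alpha>" using pmf_positive[OF x] by simp
  qed
  then have "1 < (\<Sum>x\<in>set_pmf D. pmf D x powr \<alpha>)"
    using sum_pmf_eq_1[OF fin, of D] by simp
  then show ?thesis
    using \<open>\<alpha> < 1\<close> by (simp add: renyi_entropy_def)
qed

section \<open>Product distributions\<close>

lemma replicate_pmf_Suc_eq_map_pair: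
  "replicate_pmf (Suc n) p = map_pmf (\<lambda>(x, xs). x # xs) (pair_pmf p (replicate_pmf n p))"
  by (simp add: map_pmf_def pair_pmf_def bind_assoc_pmf bind_return_pmf)

text \<open>\<open>replicate_pmf n p\<close> models the n-fold product on lists of length n. Cons is
  injective, so the mass of a list is the product of its coordinate masses, and the power sum
  factors.\<close>

lemma sum_pmf_powr_replicate_pmf:
  "(\<Sum>xs\<in>set_pmf (replicate_pmf n p). pmf (replicate_pmf n p) xs powr \<alpha>)
     = (\<Sum>x\<in>set_pmf p. pmf p x powr \<alpha>) ^ n"
proof (induction n)
  case 0
  show ?case by simp
next
  case (Suc n)
  let ?c = "\<lambda>(x, xs). x # xs :: 'a list"
  have inj: "inj ?c" by (auto simp: inj_def)
  have "(\<Sum>xs\<in>set_pmf (replicate_pmf (Suc n) p). pmf (replicate_pmf (Suc n) p) xs powr \<alpha>)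
      = (\<Sum>z\<in>set_pmf p \<times> set_pmf (replicate_pmf n p).
           pmf (pair_pmf p (replicate_pmf n p)) z powr \<alpha>)"
    unfolding replicate_pmf_Suc_eq_map_pair set_map_pmf set_pair_pmf
    by (subst sum.reindex) (auto simp: inj inj_on_subset[OF inj] pmf_map_inj'[OF inj] o_def)
  also have "\<dots> = (\<Sum>x\<in>set_pmf p. \<Sum>xs\<in>set_pmf (replicate_pmf n p).
                     pmf p x powr \<alpha> * pmf (replicate_pmf n p) xs powr \<alpha>)"
    unfolding sum.cartesian_product by (intro sum.cong) (auto simp: pmf_pair powr_mult)
  also have "\<dots> = (\<Sum>x\<in>set_pmf p. pmf p x powr \<alpha>) ^ Suc n"
    by (simp add: Suc sum_distrib_right flip: sum_distrib_left)
  finally show ?case .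
qed

lemma renyi_entropy_replicate_pmf:
  assumes "finite (set_pmf p)"
  shows "renyi_entropy \<alpha> (replicate_pmf n p) = real n * renyi_entropy \<alpha> p"
proof -
  have "0 < (\<Sum>x\<in>set_pmf p. pmf p x powr \<alpha>)"
    using assms by (intro sum_pos) (auto simp: set_pmf_iff set_pmf_not_empty)
  then show ?thesis
    by (simp add: renyi_entropy_def sum_pmf_powr_replicate_pmf log_nat_power)
qed

lemma set_replicate_pmf_eq_lists:
  "set_pmf (replicate_pmf n p) = {xs. set xs \<subseteq> set_pmf p \<and> length xs = n}"
  by (auto simp: set_replicate_pmf)

lemma quantum_speedup_replicate_pmf_ge:
  fixes chi :: "'b pmf"
  assumes fin: "finite (set_pmf chi)" and card: "card (set_pmf chi) \<ge> 2" and n: "n \<ge> 1"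
  shows "quantum_speedup (replicate_pmf n chi) \<ge>
           2 * (renyi_entropy (1/2) chi / renyi_entropy (2/3) chi)
             * (1 - log 2 (1 + real n * log 2 (real (card (set_pmf chi))))
                      / (real n * renyi_entropy (1/2) chi))"
proof -
  let ?D = "replicate_pmf n chi"
  have finD: "finite (set_pmf ?D)"
    using fin by (simp add: set_replicate_pmf_eq_lists finite_lists_length_eq)
  have cardD: "card (set_pmf ?D) = card (set_pmf chi) ^ n"
    using fin by (simp add: set_replicate_pmf_eq_lists card_lists_length_eq)
  have "card (set_pmf chi) ^ 1 \<le> card (set_pmf chi) ^ n"
    using card n by (intro power_increasing) auto
  then have "card (set_pmf ?D) \<ge> 2"
    using card cardD by simp
  from quantum_speedup_ge[OF finD this]
  have "quantum_speedup ?D \<ge>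
          2 * ((real n * renyi_entropy (1/2) chi
                  - log 2 (1 + real n * log 2 (real (card (set_pmf chi)))))
               / (real n * renyi_entropy (2/3) chi))"
    using card by (simp add: renyi_entropy_replicate_pmf[OF fin] cardD log_nat_power)
  \<comment> \<open>Factoring out the ratio of entropies leaves the relative error; positivity of
    the entropies permits the cancellation.\<close>
  moreover have "2 * ((m * H - l) / (m * H')) = 2 * (H / H') * (1 - l / (m * H))"
    if "0 < m" "0 < H" "0 < H'" for m H H' l :: real
    using that by (simp add: field_simps)
  ultimately show ?thesis
    using n fin card by (simp add: renyi_entropy_pos)
qed

text \<open>The O-term is a function \<open>f\<close> of n chosen for the fixed \<open>chi\<close>,
  so its implied constant depends on \<open>chi\<close> alone.\<close>

theorem theorem4p3:
  fixes D :: "'a pmf" and chi :: "'b pmf"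
  shows "(finite (set_pmf D) \<and> card (set_pmf D) \<ge> 2 \<longrightarrow>
            quantum_speedup D \<ge>
              2 * ((renyi_entropy (1/2) D - log 2 (1 + log 2 (real (card (set_pmf D)))))
                   / renyi_entropy (2/3) D))
       \<and> (finite (set_pmf chi) \<and> card (set_pmf chi) \<ge> 2 \<longrightarrow>
            (\<exists>f :: nat \<Rightarrow> real. f \<in> O(\<lambda>n. log 2 (real n) / real n) \<and>
              (\<forall>\<^sub>F n in sequentially.
                 quantum_speedup (replicate_pmf n chi) \<ge>
                   2 * (renyi_entropy (1/2) chi / renyi_entropy (2/3) chi) * (1 - f n))))"
proof (intro conjI impI)
  assume "finite (set_pmf D) \<and> card (set_pmf D) \<ge> 2"
  then show "quantum_speedup D \<ge>
              2 * ((renyi_entropy (1/2) D - log 2 (1 + log 2 (real (card (set_pmf D)))))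
                   / renyi_entropy (2/3) D)"
    by (simp only: quantum_speedup_ge)
next
  assume asm: "finite (set_pmf chi) \<and> card (set_pmf chi) \<ge> 2"
  define c where "c = log 2 (real (card (set_pmf chi)))"
  define h where "h = renyi_entropy (1/2) chi"
  \<comment> \<open>This is the exact relative error of the product bound; with \<open>c\<close> and
    \<open>h\<close> positive constants it is of order log n / n.\<close>
  define f where "f = (\<lambda>n::nat. log 2 (1 + real n * c) / (real n * h))"
  have c: "0 < c" using asm by (simp add: c_def)
  have h: "0 < h" using asm by (simp add: h_def renyi_entropy_pos)
  have "f \<in> O(\<lambda>n. log 2 (real n) / real n)"
    unfolding f_def using c h by real_asymp
  moreover have "\<forall>\<^sub>F n in sequentially. quantum_speedup (replicate_pmf n chi) \<ge>
                   2 * (renyi_entropy (1/2) chi / renyi_entropy (2/3) chi) * (1 - f n)"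
    using eventually_ge_at_top[of "1::nat"]
  proof eventually_elim
    case (elim n)
    then show ?case
      using quantum_speedup_replicate_pmf_ge[of chi n] asm by (simp only: f_def c_def h_def)
  qed
  ultimately show "\<exists>f :: nat \<Rightarrow> real. f \<in> O(\<lambda>n. log 2 (real n) / real n) \<and>
              (\<forall>\<^sub>F n in sequentially.
                 quantum_speedup (replicate_pmf n chi) \<ge>
                   2 * (renyi_entropy (1/2) chi / renyi_entropy (2/3) chi) * (1 - f n))"
    by blast
qed

end
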